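(* Let $G$ be a minimal $(k,4)$-cage (that is, the complete bipartite graph $K_{k,k}$). The distance spectrum of the subdivision graph $S(G)$ is $$\Big\{2k^2+k-2\pm\sqrt{4k^4-2k^3+9k^2-12k+4},\ 2k-4,\ 0^{((k-1)^2)},\ \big(-(k+2)+\sqrt{k^2+4}\big)^{(2k-2)},\ \big(-(k+2)-\sqrt{k^2+4}\big)^{(2k-2)}\Big\}.$$
   Context: All graphs are finite, simple, connected and undirected. The distance matrix $D(H)$ of a graph $H$ has $(i,j)$ entry equal to the graph distance between the $i$-th and $j$-th vertices; the distance spectrum of $H$ is the multiset of eigenvalues of $D(H)$, and $\theta^{(m)}$ denotes the eigenvalue $\theta$ with multiplicity $m$ (multiplicity $1$ if no superscript is shown); if listed values coincide, their multiplicities add. The subdivision graph $S(G)$ is obtained from $G$ by inserting a new vertex of degree $2$ on each edge of $G$. A $(k,g)$-cage is a $k$-regular simple graph of girth $g$ with the minimum possible number of vertices; a minimal $(k,g)$-cage is one attaining the Moore bound. For $g=4$ (so $k\ge2$) these are exactly the complete bipartite graphs $K_{k,k}$. *)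

theory Defs
  imports
    "Graph_Theory.Graph_Theory"
    "Jordan_Normal_Form.Char_Poly"
    "HOL-Library.Extended_Nat"
begin

text \<open>
  As in \<^theory>\<open>Graph_Theory.Digraph\<close>, a finite simple undirected graph is a symmetric digraph
  satisfying the locale predicate \<^const>\<open>graph\<close>; each undirected edge corresponds to two
  opposite arcs.
\<close>

definition k_regular :: "nat \<Rightarrow> ('a, 'b) pre_digraph \<Rightarrow> bool" where
  "k_regular k G \<longleftrightarrow> (\<forall>v \<in> verts G. out_degree G v = k)"

text \<open>
  In a symmetric digraph the walk \<open>u, v, u\<close> along an edge and back is a \<open>cycle\<close> in the
  library's sense. It is not a cycle of the undirected graph, hence the restriction to length at
  least 3. The girth of an acyclic graph is \<open>\<infinity>\<close>.
\<close>

definition girth :: "('a, 'b) pre_digraph \<Rightarrow> enat" where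
  "girth G = (INF p \<in> {p. pre_digraph.cycle G p \<and> 3 \<le> length p}. enat (length p))"

definition regular_girth_graph :: "nat \<Rightarrow> nat \<Rightarrow> ('a, 'b) pre_digraph \<Rightarrow> bool" where
  "regular_girth_graph k g G \<longleftrightarrow>
     graph G \<and> Digraph_Component.connected G \<and> k_regular k G \<and> girth G = enat g"

text \<open>
  Minimality of the order is tested against graphs with natural numbers as vertices, which
  represent all finite simple graphs up to isomorphism.
\<close>

definition cage :: "nat \<Rightarrow> nat \<Rightarrow> ('a, 'b) pre_digraph \<Rightarrow> bool" where
  "cage k g G \<longleftrightarrow> regular_girth_graph k g G \<and>
     (\<forall>H :: (nat, nat \<times> nat) pre_digraph.
        regular_girth_graph k g H \<longrightarrow> card (verts G) \<le> card (verts H))"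

text \<open>
  The bound counts the vertices at distance at most \<open>(g - 1) div 2\<close> from a fixed vertex
  (\<open>g\<close> odd) or from a fixed edge (\<open>g\<close> even).
\<close>

definition moore_bound :: "nat \<Rightarrow> nat \<Rightarrow> nat" where
  "moore_bound k g =
     (if even g then 2 * (\<Sum>i < g div 2. (k - 1) ^ i)
      else 1 + k * (\<Sum>i < g div 2. (k - 1) ^ i))"

definition minimal_cage :: "nat \<Rightarrow> nat \<Rightarrow> ('a, 'b) pre_digraph \<Rightarrow> bool" where
  "minimal_cage k g G \<longleftrightarrow> cage k g G \<and> card (verts G) = moore_bound k g"

text \<open>
  Old vertices are tagged with \<^const>\<open>Inl\<close>; the vertex inserted on the edge between \<open>u\<close> and
  \<open>v\<close> is \<open>Inr {u, v}\<close>, so the two opposite arcs of an edge share one new vertex.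
\<close>

definition subdivision_graph :: "('a, 'b) pre_digraph \<Rightarrow> ('a + 'a set) pair_pre_digraph" where
  "subdivision_graph G =
     \<lparr> pverts = Inl ` verts G \<union> {Inr {u, v} | u v. (u, v) \<in> arcs_ends G},
       parcs = {(Inl u, Inr {u, v}) | u v. (u, v) \<in> arcs_ends G} \<union>
               {(Inr {u, v}, Inl u) | u v. (u, v) \<in> arcs_ends G} \<rparr>"

definition graph_dist :: "('a, 'b) pre_digraph \<Rightarrow> 'a \<Rightarrow> 'a \<Rightarrow> real" where
  "graph_dist G u v = real_of_ereal (wf_digraph.\<mu> G (\<lambda>_. 1) u v)"

text \<open>The list \<open>vs\<close> enumerates the vertices and thereby fixes the order of rows and columns.\<close>

definition distance_matrix :: "('a, 'b) pre_digraph \<Rightarrow> 'a list \<Rightarrow> real mat" where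
  "distance_matrix G vs =
     mat (length vs) (length vs) (\<lambda>(i, j). graph_dist G (vs ! i) (vs ! j))"

text \<open>
  The eigenvalues with their algebraic multiplicities; as the distance matrix of an undirected
  graph is real symmetric, these are all its complex eigenvalues, and algebraic and geometric
  multiplicities agree.
\<close>

definition distance_spectrum :: "('a, 'b) pre_digraph \<Rightarrow> 'a list \<Rightarrow> real multiset" where
  "distance_spectrum G vs = proots (char_poly (distance_matrix G vs))"

end

theory Submission
  imports Defs
begin

text \<open>
  Counting the neighbourhoods of the two ends of an edge, a triangle-free \<open>k\<close>-regular graph on
  \<open>2 k\<close> vertices is \<open>K\<^sub>k\<^sub>,\<^sub>k\<close>. In its subdivision graph all distances depend only on which
  coordinates of two vertices agree, so the distance matrix respects the decomposition of functions
  on the edges \<open>(m, n)\<close> into products \<open>h\<^sub>i(m) h\<^sub>j(n)\<close>, for an orthogonal basis of \<open>\<real>\<^sup>k\<close> with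
  \<open>h\<^sub>0 = 1\<close>. The products with \<open>i, j > 0\<close> lie in the kernel; each \<open>h\<^sub>i\<close> with \<open>i > 0\<close>, on either side,
  gives the quadratic \<open>t\<^sup>2 + (2 k + 4) t + 4 k\<close>; the constant functions give a quadratic and the
  antisymmetric vector. Since the eigenvectors so obtained are orthogonal, their eigenvalues exhaust
  the spectrum even where some of them coincide.
\<close>

section \<open>Characteristic polynomials from orthogonal eigenvectors\<close>

text \<open>Eigenvectors are indexed by the same list as coordinates, so there are exactly as many
  as the dimension. Orthogonality makes the transpose of the eigenvector matrix \<open>P\<close>,
  with rows divided by the squared norms, an inverse of \<open>P\<close>; hence \<open>A\<close> is
  similar to the diagonal matrix of the \<open>\<theta> c\<close>.\<close>

lemma proots_char_poly_orthogonal_eigenvectors: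
  fixes M :: "'v \<Rightarrow> 'v \<Rightarrow> real" and \<phi> :: "'v \<Rightarrow> 'v \<Rightarrow> real" and \<theta> :: "'v \<Rightarrow> real"
  assumes xs: "distinct xs"
    and eig: "\<And>c u. c \<in> set xs \<Longrightarrow> u \<in> set xs \<Longrightarrow> (\<Sum>v\<in>set xs. M u v * \<phi> c v) = \<theta> c * \<phi> c u"
    and orth: "\<And>c d. c \<in> set xs \<Longrightarrow> d \<in> set xs \<Longrightarrow> c \<noteq> d \<Longrightarrow> (\<Sum>v\<in>set xs. \<phi> c v * \<phi> d v) = 0"
    and nz: "\<And>c. c \<in> set xs \<Longrightarrow> (\<Sum>v\<in>set xs. \<phi> c v * \<phi> c v) \<noteq> 0"
  shows "proots (char_poly (mat (length xs) (length xs) (\<lambda>(i, j). M (xs ! i) (xs ! j)))) =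
    image_mset \<theta> (mset xs)"
proof -
  define n where "n = length xs"
  define A where "A = mat n n (\<lambda>(i, j). M (xs ! i) (xs ! j))"
  define P where "P = mat n n (\<lambda>(i, j). \<phi> (xs ! j) (xs ! i))"
  define Q where "Q = mat n n (\<lambda>(i, j). \<phi> (xs ! i) (xs ! j) / (\<Sum>v\<in>set xs. \<phi> (xs ! i) v * \<phi> (xs ! i) v))"
  define T where "T = mat n n (\<lambda>(i, j). if i = j then \<theta> (xs ! i) else 0)"
  have carr: "A \<in> carrier_mat n n" "P \<in> carrier_mat n n" "Q \<in> carrier_mat n n" "T \<in> carrier_mat n n"
    by (simp_all add: A_def P_def Q_def T_def)
  have sum_nth: "(\<Sum>i = 0..<n. f (xs ! i)) = sum f (set xs)" for f :: "'v \<Rightarrow> real"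
    using sum.reindex_bij_betw[OF bij_betw_nth[OF xs, of "{0..<n}" "set xs"], of f]
    by (simp add: n_def lessThan_atLeast0)
  have QP: "Q * P = 1\<^sub>m n"
  proof (rule eq_matI)
    fix i j assume "i < dim_row (1\<^sub>m n :: real mat)" "j < dim_col (1\<^sub>m n :: real mat)"
    then have ij: "i < n" "j < n" by auto
    then have mem: "xs ! i \<in> set xs" "xs ! j \<in> set xs" by (auto simp: n_def)
    have "(Q * P) $$ (i, j) = (\<Sum>l = 0..<n. \<phi> (xs ! i) (xs ! l) / (\<Sum>v\<in>set xs. \<phi> (xs ! i) v * \<phi> (xs ! i) v) * \<phi> (xs ! j) (xs ! l))"
      using ij by (simp add: P_def Q_def scalar_prod_def)
    also have "\<dots> = (\<Sum>v\<in>set xs. \<phi> (xs ! i) v * \<phi> (xs ! j) v) / (\<Sum>v\<in>set xs. \<phi> (xs ! i) v * \<phi> (xs ! i) v)"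
      unfolding sum_nth[of "\<lambda>v. \<phi> (xs ! i) v / _ * \<phi> (xs ! j) v"] by (simp add: sum_divide_distrib)
    also have "\<dots> = (1\<^sub>m n) $$ (i, j)"
      using ij mem orth[OF mem] nz xs by (auto simp: n_def nth_eq_iff_index_eq)
    finally show "(Q * P) $$ (i, j) = (1\<^sub>m n) $$ (i, j)" .
  qed (use carr in auto)
  have PQ: "P * Q = 1\<^sub>m n"
    using mat_mult_left_right_inverse[OF carr(3,2) QP] .
  have AP: "A * P = P * T"
  proof (rule eq_matI)
    fix i j assume "i < dim_row (P * T)" "j < dim_col (P * T)"
    then have ij: "i < n" "j < n" using carr by auto
    then have mem: "xs ! i \<in> set xs" "xs ! j \<in> set xs" by (auto simp: n_def)
    have "(A * P) $$ (i, j) = (\<Sum>l = 0..<n. M (xs ! i) (xs ! l) * \<phi> (xs ! j) (xs ! l))"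
      using ij by (simp add: P_def A_def scalar_prod_def)
    also have "\<dots> = \<theta> (xs ! j) * \<phi> (xs ! j) (xs ! i)"
      using sum_nth[of "\<lambda>v. M (xs ! i) v * \<phi> (xs ! j) v"] eig[OF mem(2,1)] by simp
    also have "\<dots> = (P * T) $$ (i, j)"
      using ij by (simp add: P_def T_def scalar_prod_def if_distrib cong: if_cong)
    finally show "(A * P) $$ (i, j) = (P * T) $$ (i, j)" .
  qed (use carr in auto)
  have "A = A * (P * Q)"
    using PQ carr by simp
  also have "\<dots> = P * T * Q"
    using AP assoc_mult_mat[OF carr(1,2,3)] by simp
  finally have "similar_mat A T"
    using carr PQ QP by (intro similar_matI[of A T P Q n]) auto
  then have "char_poly A = char_poly T"
    by (rule char_poly_similar)
  also have "\<dots> = (\<Prod>a\<leftarrow>diag_mat T. [:- a, 1:])"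
    using carr(4) by (rule char_poly_upper_triangular) (auto simp: T_def upper_triangular_def)
  also have "diag_mat T = map \<theta> xs"
    by (auto simp: diag_mat_def T_def n_def intro: nth_equalityI)
  finally have "char_poly A = (\<Prod>a\<leftarrow>map \<theta> xs. [:- a, 1:])" .
  moreover have "proots (\<Prod>a\<leftarrow>ys. [:- a, 1:]) = mset ys" for ys :: "real list"
  proof (induction ys)
    case (Cons a ys)
    have "(\<Prod>a\<leftarrow>ys. [:- a, 1:]) \<noteq> 0"
      by (auto simp: prod_list_zero_iff)
    then show ?case
      using Cons by (simp add: proots_mult del: mult_pCons_left)
  qed simp
  ultimately show ?thesis
    unfolding A_def n_def by (metis mset_map)
qed

section \<open>Distances and minimal cages\<close>

text \<open>A local certificate for distances. Growth by at most one along arcs makes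
  \<open>f\<close> a lower bound for walk lengths; descending through predecessors reaches
  \<open>s\<close> by a walk attaining it.\<close>

lemma wf_digraph_graph_dist_eqI:
  fixes H :: "('a, 'b) pre_digraph" and f :: "'a \<Rightarrow> nat"
  assumes wf: "wf_digraph H" and s: "s \<in> verts H" and fs: "f s = 0"
    and step: "\<And>x y. (x, y) \<in> arcs_ends H \<Longrightarrow> f y \<le> f x + 1"
    and pred: "\<And>y. y \<in> verts H \<Longrightarrow> y \<noteq> s \<Longrightarrow> \<exists>x. (x, y) \<in> arcs_ends H \<and> f y = f x + 1"
    and t: "t \<in> verts H"
  shows "graph_dist H s t = f t"
proof -
  interpret wf_digraph H by fact
  have cost: "awalk_cost (\<lambda>_. 1) p = length p" for p
    by (induction p) auto
  have lower: "f v \<le> f u + length p" if "awalk u p v" for u p v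
    using that
  proof (induction p arbitrary: u)
    case (Cons e p)
    then have "awalk (head H e) p v" "(u, head H e) \<in> arcs_ends H"
      by (auto simp: awalk_Cons_iff arcs_ends_conv)
    then show ?case
      using Cons.IH step[of u "head H e"] by fastforce
  qed (auto simp: awalk_Nil_iff)
  have upper: "\<exists>p. awalk s p v \<and> length p = f v" if "v \<in> verts H" for v
    using that
  proof (induction "f v" arbitrary: v rule: less_induct)
    case less
    show ?case
    proof (cases "v = s")
      case True
      then show ?thesis using s fs by (auto simp: awalk_Nil_iff)
    next
      case False
      with pred less.prems obtain x where x: "(x, v) \<in> arcs_ends H" "f v = f x + 1"
        by blast
      then obtain e where e: "e \<in> arcs H" "tail H e = x" "head H e = v"
        by (auto simp: arcs_ends_conv)
      with less.hyps[of x] x obtain p where "awalk s p x" "length p = f x"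
        by auto
      then have "awalk s (p @ [e]) v \<and> length (p @ [e]) = f v"
        using e x less.prems by (auto simp: awalk_simps)
      then show ?thesis by blast
    qed
  qed
  have "\<mu> (\<lambda>_. 1) s t = ereal (f t)"
  proof (rule antisym)
    obtain p where "awalk s p t" "length p = f t"
      using upper[OF t] by blast
    then show "\<mu> (\<lambda>_. 1) s t \<le> ereal (f t)"
      using min_cost_le_walk_cost[of s p t "\<lambda>_. 1"] by (simp add: cost)
    show "ereal (f t) \<le> \<mu> (\<lambda>_. 1) s t"
      unfolding \<mu>_def using lower[of s _ t] fs by (intro INF_greatest) (simp add: cost)
  qed
  then show ?thesis
    by (simp add: graph_dist_def)
qed

lemma girth_4_no_triangle:
  fixes G :: "('a, 'b) pre_digraph"
  assumes "graph G" and girth: "girth G = 4"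
    and uv: "(u, v) \<in> arcs_ends G" and vw: "(v, w) \<in> arcs_ends G" and wu: "(w, u) \<in> arcs_ends G"
  shows False
proof -
  interpret graph G by fact
  from uv vw wu obtain a b c where arcs: "a \<in> arcs G" "b \<in> arcs G" "c \<in> arcs G"
    "tail G a = u" "head G a = v" "tail G b = v" "head G b = w" "tail G c = w" "head G c = u"
    by (auto simp: arcs_ends_conv)
  then have "u \<noteq> v" "v \<noteq> w" "w \<noteq> u"
    using no_loops[of a] no_loops[of b] no_loops[of c] by auto
  with arcs have "cycle [a, b, c]"
    by (auto simp: cycle_def awalk_simps intro!: exI[of _ u])
  then have "girth G \<le> enat (length [a, b, c])"
    unfolding girth_def by (intro INF_lower) auto
  then show False
    using girth by (simp add: numeral_eq_enat)
qed

text \<open>Without arcs the girth is an infimum over the empty set. This supplies the edge from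
  which the counting argument starts.\<close>

lemma girth_finite_arcs_nonempty:
  assumes "girth G \<noteq> \<infinity>" and "wf_digraph G"
  shows "arcs_ends G \<noteq> {}"
proof
  interpret wf_digraph G by fact
  assume "arcs_ends G = {}"
  then have "\<not> cycle p" for p
    by (cases p) (auto simp: cycle_def awalk_simps arcs_ends_conv)
  then show False
    using assms(1) by (simp add: girth_def top_enat_def)
qed

lemma minimal_cage_4_complete_bipartite:
  fixes G :: "('a, 'b) pre_digraph"
  assumes "minimal_cage k 4 G"
  obtains A B where "finite A" "finite B" "card A = k" "card B = k" "A \<inter> B = {}"
    "verts G = A \<union> B" "arcs_ends G = A \<times> B \<union> B \<times> A" "k > 0"
proof -
  have G: "graph G" and reg: "k_regular k G" and gi: "girth G = 4"
    and card: "card (verts G) = moore_bound k 4"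
    using assms by (auto simp: minimal_cage_def cage_def regular_girth_graph_def numeral_eq_enat)
  interpret graph G by fact
  define N where "N u = {v. (u, v) \<in> arcs_ends G}" for u
  have N_verts: "N u \<subseteq> verts G" for u
    by (auto simp: N_def arcs_ends_conv)
  have fin: "finite (N u)" for u
    using N_verts finite_verts by (rule finite_subset)
  have card_N: "card (N u) = k" if "u \<in> verts G" for u
  proof -
    have "N u = head G ` out_arcs G u"
      by (auto simp: N_def arcs_ends_conv)
    moreover have "inj_on (head G) (out_arcs G u)"
      using no_multi_arcs by (auto simp: inj_on_def arc_to_ends_def)
    ultimately show ?thesis
      using reg that by (simp add: k_regular_def out_degree_def card_image)
  qed
  have sym: "v \<in> N u \<longleftrightarrow> u \<in> N v" for u v
    using sym_arcs by (auto simp: N_def symmetric_def dest: symD)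
  have tri: "\<lbrakk>v \<in> N u; w \<in> N v; u \<in> N w\<rbrakk> \<Longrightarrow> False" for u v w
    using girth_4_no_triangle[OF G gi, of u v w] by (simp add: N_def)
  obtain u v where uv: "v \<in> N u"
    using girth_finite_arcs_nonempty[of G] gi wf_digraph by (auto simp: N_def numeral_eq_enat)
  then have verts: "u \<in> verts G" "v \<in> verts G"
    using N_verts sym by blast+
  have k: "k > 0"
    using uv card_N[OF verts(1)] fin[of u] by (auto simp: card_gt_0_iff)
  have disj: "N u \<inter> N v = {}"
    using tri uv sym by blast
  \<comment> \<open>The bound is \<open>2 * (1 + (k - 1))\<close>; as the subtraction is truncated,
    \<open>k > 0\<close> is what turns it into \<open>2 * k\<close>.\<close>
  have "{..<4 div 2 :: nat} = {0, 1}" by auto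
  then have "card (verts G) = 2 * k"
    using card k by (simp add: moore_bound_def)
  then have union: "verts G = N u \<union> N v"
    using N_verts disj fin card_N verts
    by (intro card_subset_eq[symmetric]) (auto simp: card_Un_disjoint)
  \<comment> \<open>A neighbour of \<open>u\<close> adjacent to another neighbour of
    \<open>u\<close> would close a triangle, so its \<open>k\<close> neighbours all lie in
    \<open>N v\<close>, which has only \<open>k\<close> elements.\<close>
  have Nu: "N w = N v" if "w \<in> N u" for w
  proof (rule card_subset_eq)
    show "N w \<subseteq> N v"
      using union N_verts[of w] tri[OF that] sym[of _ u] by blast
    show "card (N w) = card (N v)"
      using that N_verts card_N verts by (metis subsetD)
  qed (rule fin)
  have Nv: "N w = N u" if "w \<in> N v" for w
  proof (rule card_subset_eq)
    show "N w \<subseteq> N u"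
      using union N_verts[of w] tri[OF that] sym[of _ v] by blast
    show "card (N w) = card (N u)"
      using that N_verts card_N verts by (metis subsetD)
  qed (rule fin)
  have "(x, y) \<in> arcs_ends G \<longleftrightarrow> (x, y) \<in> N u \<times> N v \<union> N v \<times> N u" for x y
  proof -
    have "(x, y) \<in> arcs_ends G \<longleftrightarrow> x \<in> verts G \<and> y \<in> N x"
      using N_verts[of y] sym[of y x] by (auto simp: N_def)
    also have "\<dots> \<longleftrightarrow> (x, y) \<in> N u \<times> N v \<union> N v \<times> N u"
      using Nu[of x] Nv[of x] union by (metis Un_iff mem_Sigma_iff disjoint_iff disj)
    finally show ?thesis .
  qed
  then have "arcs_ends G = N u \<times> N v \<union> N v \<times> N u"
    by auto
  then show thesis
    using that[of "N u" "N v"] fin card_N verts disj union k by auto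
qed

section \<open>Eigenvectors for the complete bipartite graph\<close>

text \<open>The same labels index the vertices of the subdivision graph and, below, the eigenvectors.\<close>

datatype label = Lft nat | Rgt nat | Edge nat nat

definition labels :: "nat \<Rightarrow> label set" where
  "labels k = Lft ` {..<k} \<union> Rgt ` {..<k} \<union> case_prod Edge ` ({..<k} \<times> {..<k})"

lemma labels_iff [simp]:
  "Lft i \<in> labels k \<longleftrightarrow> i < k"
  "Rgt i \<in> labels k \<longleftrightarrow> i < k"
  "Edge i j \<in> labels k \<longleftrightarrow> i < k \<and> j < k"
  by (auto simp: labels_def)

lemma mset_set_labels:
  "mset_set (labels k) = image_mset Lft (mset_set {..<k}) + image_mset Rgt (mset_set {..<k})
     + image_mset (case_prod Edge) (mset_set ({..<k} \<times> {..<k}))"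
proof -
  have "mset_set (labels k) = mset_set (Lft ` {..<k}) + mset_set (Rgt ` {..<k})
     + mset_set (case_prod Edge ` ({..<k} \<times> {..<k}))"
    unfolding labels_def by (subst mset_set_Union | force)+
  then show ?thesis
    by (simp add: image_mset_mset_set inj_on_def)
qed

lemma finite_labels [simp]: "finite (labels k)"
  by (simp add: labels_def)

lemma sum_labels:
  "sum f (labels k) =
    (\<Sum>i<k. f (Lft i)) + (\<Sum>j<k. f (Rgt j)) + (\<Sum>i<k. \<Sum>j<k. f (Edge i j))"
  for f :: "label \<Rightarrow> real"
  unfolding sum_unfold_sum_mset mset_set_labels
  by (simp add: image_mset.compositionality comp_def sum.cartesian_product case_prod_unfold
      flip: sum_unfold_sum_mset)

text \<open>The distances in the subdivision of \<open>K_{k,k}\<close>. Two edges sharing an end are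
  at distance 2, disjoint ones at distance 4; writing this as one summand per coordinate lets the
  edge block act on product vectors factor by factor.\<close>

fun label_dist :: "label \<Rightarrow> label \<Rightarrow> nat" where
  "label_dist (Lft i) (Lft j) = (if i = j then 0 else 4)"
| "label_dist (Rgt i) (Rgt j) = (if i = j then 0 else 4)"
| "label_dist (Lft i) (Rgt j) = 2"
| "label_dist (Rgt i) (Lft j) = 2"
| "label_dist (Lft i) (Edge m n) = (if i = m then 1 else 3)"
| "label_dist (Rgt j) (Edge m n) = (if j = n then 1 else 3)"
| "label_dist (Edge m n) (Lft i) = (if m = i then 1 else 3)"
| "label_dist (Edge m n) (Rgt j) = (if n = j then 1 else 3)"
| "label_dist (Edge i j) (Edge m n) = (if i = m then 0 else 2) + (if j = n then 0 else 2)"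

text \<open>Unnormalised rows of the Helmert matrix: an explicit real orthogonal basis that contains
  the constant vector and whose members do not depend on the dimension.\<close>

definition helmert :: "nat \<Rightarrow> nat \<Rightarrow> real" where
  "helmert i m = (if i = 0 \<or> m < i then 1 else if m = i then - real i else 0)"

lemma helmert_0 [simp]: "helmert 0 m = 1"
  by (simp add: helmert_def)

lemma sum_helmert:
  assumes "i < k"
  shows "(\<Sum>m<k. helmert i m) = (if i = 0 then real k else 0)"
proof (cases "i = 0")
  case False
  have "(\<Sum>m<k. helmert i m) = (\<Sum>m<Suc i. helmert i m)"
    using assms False by (intro sum.mono_neutral_right) (auto simp: helmert_def)
  also have "\<dots> = 0"
    using False by (simp add: helmert_def)
  finally show ?thesis
    using False by simp
qed simp

text \<open>For \<open>0 < i < j\<close> the later vector is constantly 1 on the support of the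
  earlier one, so the inner product is the entry sum of \<open>helmert i\<close>, which
  vanishes.\<close>

lemma helmert_orthogonal_less:
  assumes "i < j" "j < k"
  shows "(\<Sum>m<k. helmert i m * helmert j m) = 0"
proof (cases "i = 0")
  case True
  then show ?thesis using assms sum_helmert[of j k] by simp
next
  case False
  have "(\<Sum>m<k. helmert i m * helmert j m) = (\<Sum>m<k. helmert i m)"
    using assms False by (intro sum.cong) (auto simp: helmert_def)
  then show ?thesis
    using assms False sum_helmert[of i k] by simp
qed

lemma helmert_orthogonal:
  assumes "i < k" "j < k" "i \<noteq> j"
  shows "(\<Sum>m<k. helmert i m * helmert j m) = 0"
  using assms helmert_orthogonal_less[of i j k] helmert_orthogonal_less[of j i k]
  by (cases "i < j") (auto simp: mult.commute)

lemma helmert_norm_pos: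
  assumes "i < k"
  shows "(\<Sum>m<k. helmert i m * helmert i m) > 0"
  using assms by (intro sum_pos2[of _ i]) (auto simp: helmert_def)

text \<open>The pair selects the product \<open>h\<^sub>i \<otimes> h\<^sub>j\<close> of Helmert vectors, the triple its weights on the
  left vertices, the right vertices and the edges.\<close>

fun wave :: "nat \<times> nat \<Rightarrow> real \<times> real \<times> real \<Rightarrow> label \<Rightarrow> real" where
  "wave (i, j) (p, q, r) (Lft m) = p * helmert i m"
| "wave (i, j) (p, q, r) (Rgt n) = q * helmert j n"
| "wave (i, j) (p, q, r) (Edge m n) = r * (helmert i m * helmert j n)"

lemma sum_wave_mult:
  "(\<Sum>v\<in>labels k. wave (i, j) (p, q, r) v * wave (i', j') (p', q', r') v) =
     p * p' * (\<Sum>m<k. helmert i m * helmert i' m) + q * q' * (\<Sum>n<k. helmert j n * helmert j' n)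
     + r * r' * ((\<Sum>m<k. helmert i m * helmert i' m) * (\<Sum>n<k. helmert j n * helmert j' n))"
  unfolding sum_labels sum_product by (simp add: sum_distrib_left mult_ac)

section \<open>Action of the distance matrix on product vectors\<close>

lemma sum_if_eq_mult:
  fixes f :: "nat \<Rightarrow> real"
  assumes "i < k"
  shows "(\<Sum>m<k. (if i = m then a else b) * f m) = b * sum f {..<k} + (a - b) * f i"
proof -
  have "(\<Sum>m<k. (if i = m then a else b) * f m) = (\<Sum>m<k. b * f m + (if i = m then (a - b) * f m else 0))"
    by (intro sum.cong) (auto simp: algebra_simps)
  then show ?thesis
    using assms by (simp add: sum.distrib sum_distrib_left)
qed

text \<open>With \<open>J\<close> the all-ones matrix, the blocks are \<open>4J - 4I\<close> within
  a side, \<open>2J\<close> across, \<open>3J - 2I\<close> in the relevant coordinate between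
  vertices and edges, and a sum of two products of \<open>2J - 2I\<close> with \<open>J\<close>
  among edges. The sums \<open>s\<close> stay symbolic, so one formula serves constant and
  nonconstant factors.\<close>

lemma label_dist_wave:
  assumes "m < k" "n < k"
  defines "s \<equiv> \<lambda>i. \<Sum>m<k. helmert i m"
  shows "(\<Sum>v\<in>labels k. label_dist (Lft m) v * wave (i, j) (p, q, r) v) =
      p * (4 * s i - 4 * helmert i m) + q * (2 * s j) + r * (3 * s i - 2 * helmert i m) * s j"
    and "(\<Sum>v\<in>labels k. label_dist (Rgt n) v * wave (i, j) (p, q, r) v) =
      p * (2 * s i) + q * (4 * s j - 4 * helmert j n) + r * s i * (3 * s j - 2 * helmert j n)"
    and "(\<Sum>v\<in>labels k. label_dist (Edge m n) v * wave (i, j) (p, q, r) v) =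
      p * (3 * s i - 2 * helmert i m) + q * (3 * s j - 2 * helmert j n)
      + r * (4 * s i * s j - 2 * helmert i m * s j - 2 * s i * helmert j n)"
proof -
  have real_if: "real (if b then x else y) = (if b then real x else real y)" for b x y
    by simp
  have double: "(\<Sum>x<k. \<Sum>y<k. a x * (r * (helmert i x * b y))) =
      r * ((\<Sum>x<k. a x * helmert i x) * (\<Sum>y<k. b y))"
    for a b :: "nat \<Rightarrow> real"
    by (simp add: sum_product sum_distrib_left mult_ac)
  show "(\<Sum>v\<in>labels k. label_dist (Lft m) v * wave (i, j) (p, q, r) v) =
      p * (4 * s i - 4 * helmert i m) + q * (2 * s j) + r * (3 * s i - 2 * helmert i m) * s j"
  proof -
    have "(\<Sum>v\<in>labels k. label_dist (Lft m) v * wave (i, j) (p, q, r) v) =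
      p * (\<Sum>x<k. (if m = x then 0 else 4) * helmert i x) + q * (2 * s j)
      + r * ((\<Sum>x<k. (if m = x then 1 else 3) * helmert i x) * s j)"
      unfolding sum_labels s_def double[symmetric]
      by (simp add: real_if sum_distrib_left mult_ac cong: if_cong)
    then show ?thesis
      unfolding sum_if_eq_mult[OF assms(1)] s_def by (simp add: algebra_simps)
  qed
  show "(\<Sum>v\<in>labels k. label_dist (Rgt n) v * wave (i, j) (p, q, r) v) =
      p * (2 * s i) + q * (4 * s j - 4 * helmert j n) + r * s i * (3 * s j - 2 * helmert j n)"
  proof -
    have "(\<Sum>v\<in>labels k. label_dist (Rgt n) v * wave (i, j) (p, q, r) v) =
      p * (2 * s i) + q * (\<Sum>y<k. (if n = y then 0 else 4) * helmert j y)
      + r * ((\<Sum>x<k. 1 * helmert i x) * (\<Sum>y<k. (if n = y then 1 else 3) * helmert j y))"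
      unfolding sum_labels s_def double[symmetric]
      by (simp add: real_if sum_distrib_left mult_ac cong: if_cong)
    then show ?thesis
      unfolding sum_if_eq_mult[OF assms(2)] s_def by (simp add: algebra_simps)
  qed
  show "(\<Sum>v\<in>labels k. label_dist (Edge m n) v * wave (i, j) (p, q, r) v) =
      p * (3 * s i - 2 * helmert i m) + q * (3 * s j - 2 * helmert j n)
      + r * (4 * s i * s j - 2 * helmert i m * s j - 2 * s i * helmert j n)"
  proof -
    \<comment> \<open>The edge distance is split by coordinate; the explicit factor 1 brings the
      second summand into the form of \<open>double\<close>.\<close>
    have "(\<Sum>x<k. \<Sum>y<k. real (label_dist (Edge m n) (Edge x y)) * wave (i, j) (p, q, r) (Edge x y)) =
      (\<Sum>x<k. \<Sum>y<k. (if m = x then 0 else 2) * (r * (helmert i x * helmert j y)) +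
        1 * (r * (helmert i x * ((if n = y then 0 else 2) * helmert j y))))"
      by (intro sum.cong refl) (simp add: distrib_right)
    also have "\<dots> = r * ((\<Sum>x<k. (if m = x then 0 else 2) * helmert i x) * s j)
      + r * ((\<Sum>x<k. 1 * helmert i x) * (\<Sum>y<k. (if n = y then 0 else 2) * helmert j y))"
      unfolding sum.distrib double s_def ..
    finally have edges: "(\<Sum>x<k. \<Sum>y<k. label_dist (Edge m n) (Edge x y) * wave (i, j) (p, q, r) (Edge x y)) = \<dots>" .
    have lft: "(\<Sum>x<k. label_dist (Edge m n) (Lft x) * wave (i, j) (p, q, r) (Lft x)) =
        p * (\<Sum>x<k. (if m = x then 1 else 3) * helmert i x)"
      by (simp add: real_if sum_distrib_left mult_ac cong: if_cong)
    have rgt: "(\<Sum>y<k. label_dist (Edge m n) (Rgt y) * wave (i, j) (p, q, r) (Rgt y)) =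
        q * (\<Sum>y<k. (if n = y then 1 else 3) * helmert j y)"
      by (simp add: real_if sum_distrib_left mult_ac cong: if_cong)
    show ?thesis
      unfolding sum_labels lft rgt edges sum_if_eq_mult[OF assms(1)] sum_if_eq_mult[OF assms(2)] s_def
      by (simp add: algebra_simps)
  qed
qed

section \<open>Eigenvalues and eigenvectors, with \<open>e\<close> the sign of the square
  root\<close>

definition root_theta :: "real \<Rightarrow> real \<Rightarrow> real" where
  "root_theta e k = - (k + 2) + e * sqrt (k\<^sup>2 + 4)"

definition root_mu :: "real \<Rightarrow> real \<Rightarrow> real" where
  "root_mu e k = 2 * k\<^sup>2 + k - 2 + e * sqrt (4 * k ^ 4 - 2 * k ^ 3 + 9 * k\<^sup>2 - 12 * k + 4)"

text \<open>Labels sharing a mode span its eigenvectors: \<open>Lft i\<close> and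
  \<open>Edge i 0\<close> for the mode \<open>(i, 0)\<close>, \<open>Rgt j\<close> and
  \<open>Edge 0 j\<close> for \<open>(0, j)\<close>, three labels for \<open>(0, 0)\<close>, and
  only \<open>Edge i j\<close> when both indices are positive. Of a conjugate pair of eigenvalues,
  the edge label takes the plus sign.\<close>

fun mode :: "label \<Rightarrow> nat \<times> nat" where
  "mode (Lft i) = (i, 0)"
| "mode (Rgt j) = (0, j)"
| "mode (Edge i j) = (i, j)"

fun label_eigenvalue :: "nat \<Rightarrow> label \<Rightarrow> real" where
  "label_eigenvalue k (Lft i) = (if i = 0 then root_mu (-1) k else root_theta (-1) k)"
| "label_eigenvalue k (Rgt j) = (if j = 0 then 2 * real k - 4 else root_theta (-1) k)"
| "label_eigenvalue k (Edge i j) =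
    (if i = 0 \<and> j = 0 then root_mu 1 k else if i = 0 \<or> j = 0 then root_theta 1 k else 0)"

text \<open>The edge weight solves the first row of the reduced \<open>2 \<times> 2\<close> eigenvalue problem.\<close>

definition weights :: "nat \<Rightarrow> label \<Rightarrow> real \<times> real \<times> real" where
  "weights k c = (let t = label_eigenvalue k c; x = 3 * real k ^ 2 - 2 * real k in
    if c = Rgt 0 then (1, -1, 0)
    else if mode c = (0, 0) then (x, x, t - (6 * real k - 4))
    else if snd (mode c) = 0 then (2 * real k, 0, - (t + 4))
    else if fst (mode c) = 0 then (0, 2 * real k, - (t + 4))
    else (0, 0, 1))"

definition label_eigenvector :: "nat \<Rightarrow> label \<Rightarrow> label \<Rightarrow> real" where
  "label_eigenvector k c = wave (mode c) (weights k c)"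

(* Unqualified, the name algebra would refer to the normaliser of HOL-Algebra. *)
lemma root_theta_quadratic:
  assumes "e = 1 \<or> e = -1"
  shows "root_theta e k ^ 2 + (2 * k + 4) * root_theta e k + 4 * k = 0"
proof -
  have "sqrt (k\<^sup>2 + 4) ^ 2 = k\<^sup>2 + 4" by simp
  then show ?thesis
    using assms unfolding root_theta_def by (elim disjE; simp only:) Groebner_Basis.algebra+
qed

text \<open>The left side is the quadratic of \<open>root_theta\<close> evaluated at -4. The factors
  are, up to sign, the edge weights of the two eigenvectors of a mode, so this gives their
  orthogonality.\<close>

lemma root_theta_mult: "(root_theta 1 k + 4) * (root_theta (-1) k + 4) = - 4 * k"
proof -
  have "sqrt (k\<^sup>2 + 4) ^ 2 = k\<^sup>2 + 4" by simp
  then show ?thesis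
    unfolding root_theta_def by Groebner_Basis.algebra
qed

lemma root_mu_sqrt:
  fixes k :: real
  assumes "k \<ge> 0"
  shows "sqrt (4 * k ^ 4 - 2 * k ^ 3 + 9 * k\<^sup>2 - 12 * k + 4) ^ 2 = 4 * k ^ 4 - 2 * k ^ 3 + 9 * k\<^sup>2 - 12 * k + 4"
proof -
  \<comment> \<open>On symmetric constant vectors the matrix reduces to rows
    \<open>(6k - 4, 3k^2 - 2k)\<close> and \<open>(6k - 4, 4k^2 - 4k)\<close>. The radicand is the
    square of half the difference of its diagonal entries plus the product of its off-diagonal
    entries.\<close>
  have "4 * k ^ 4 - 2 * k ^ 3 + 9 * k\<^sup>2 - 12 * k + 4 = (2 * k\<^sup>2 - 5 * k + 2)\<^sup>2 + 2 * k * (3 * k - 2)\<^sup>2"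
    by Groebner_Basis.algebra
  also have "\<dots> \<ge> 0"
    using assms by simp
  finally show ?thesis
    by simp
qed

text \<open>The polynomial is the characteristic polynomial of the reduced matrix on symmetric
  constant vectors.\<close>

lemma root_mu_quadratic:
  assumes "e = 1 \<or> e = -1" "k \<ge> 0"
  shows "root_mu e k ^ 2 - (4 * k\<^sup>2 + 2 * k - 4) * root_mu e k + (6 * k - 4) * (k\<^sup>2 - 2 * k) = 0"
  using assms(1) root_mu_sqrt[OF assms(2)] unfolding root_mu_def by (elim disjE; simp only:) Groebner_Basis.algebra+

text \<open>The same polynomial at the diagonal entry \<open>6k - 4\<close>, where only minus the
  product of the off-diagonal entries survives.\<close>

lemma root_mu_mult:
  assumes "k \<ge> 0"
  shows "(root_mu 1 k - (6 * k - 4)) * (root_mu (-1) k - (6 * k - 4)) = - 2 * k * (3 * k - 2) ^ 2"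
  using root_mu_sqrt[OF assms] unfolding root_mu_def by Groebner_Basis.algebra

text \<open>Conjugate eigenvalues are merged: only a root \<open>t\<close> and its quadratic are
  kept, so both signs are treated by one computation.\<close>

lemma weights_cases:
  assumes "c \<in> labels k"
  obtains (anti) "mode c = (0, 0)" "weights k c = (1, -1, 0)" "label_eigenvalue k c = 2 * real k - 4"
  | (const) t where "label_eigenvalue k c = t" "mode c = (0, 0)"
      "weights k c = (3 * real k ^ 2 - 2 * real k, 3 * real k ^ 2 - 2 * real k, t - (6 * real k - 4))"
      "t\<^sup>2 - (4 * real k ^ 2 + 2 * real k - 4) * t + (6 * real k - 4) * (real k ^ 2 - 2 * real k) = 0"
  | (left) i t where "label_eigenvalue k c = t" "i < k" "i > 0" "mode c = (i, 0)"
      "weights k c = (2 * real k, 0, - (t + 4))" "t\<^sup>2 + (2 * real k + 4) * t + 4 * real k = 0"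
  | (right) j t where "label_eigenvalue k c = t" "j < k" "j > 0" "mode c = (0, j)"
      "weights k c = (0, 2 * real k, - (t + 4))" "t\<^sup>2 + (2 * real k + 4) * t + 4 * real k = 0"
  | (both) i j where "i < k" "j < k" "i > 0" "j > 0" "mode c = (i, j)" "weights k c = (0, 0, 1)"
      "label_eigenvalue k c = 0"
proof (cases "mode c")
  case (Pair i j)
  then have ij: "i < k" "j < k"
    using assms by (cases c; simp)+
  consider "c = Rgt 0" | "i = 0" "j = 0" "c \<noteq> Rgt 0" | "i > 0" "j = 0" | "i = 0" "j > 0" | "i > 0" "j > 0"
    by blast
  then show thesis
  proof cases
    case 1
    then show ?thesis by (intro anti) (simp_all add: weights_def)
  next
    case 2
    then have "label_eigenvalue k c = root_mu 1 k \<or> label_eigenvalue k c = root_mu (-1) k"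
      using Pair by (cases c) auto
    then show ?thesis
      using 2 Pair root_mu_quadratic[of 1 "real k"] root_mu_quadratic[of "-1" "real k"]
      by (intro const[OF refl]) (auto simp: weights_def Let_def)
  next
    case 3
    then have "label_eigenvalue k c = root_theta 1 k \<or> label_eigenvalue k c = root_theta (-1) k"
      using Pair by (cases c) auto
    then show ?thesis
      using 3 ij Pair root_theta_quadratic[of 1 "real k"] root_theta_quadratic[of "-1" "real k"]
      by (intro left[OF refl, of i]) (auto simp: weights_def Let_def)
  next
    case 4
    then have "label_eigenvalue k c = root_theta 1 k \<or> label_eigenvalue k c = root_theta (-1) k"
      using Pair by (cases c) auto
    then show ?thesis
      using 4 ij Pair root_theta_quadratic[of 1 "real k"] root_theta_quadratic[of "-1" "real k"]
      by (intro right[OF refl, of j]) (auto simp: weights_def Let_def)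
  next
    case 5
    then show ?thesis
      using ij Pair by (intro both[of i j]) (cases c; auto simp: weights_def Let_def)+
  qed
qed

lemma eigenvector_eigenvalue:
  assumes c: "c \<in> labels k" and u: "u \<in> labels k"
  shows "(\<Sum>v\<in>labels k. label_dist u v * label_eigenvector k c v) = label_eigenvalue k c * label_eigenvector k c u"
proof -
  \<comment> \<open>For an old vertex \<open>u\<close> the other index is arbitrary; it serves to
    instantiate all three row formulas at once.\<close>
  obtain m n where mn: "m < k" "n < k" "u = Lft m \<or> u = Rgt n \<or> u = Edge m n"
    using u by (cases u) auto
  note wave = label_dist_wave[OF mn(1,2)] sum_helmert
  have k: "0 < k" using mn by simp
  \<comment> \<open>The weights solve the rows of old vertices identically in \<open>t\<close>; the
    edge row is the one that needs the quadratic.\<close>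
  have mu_edge: "2 * ((3 * x - 2) * (3 * x\<^sup>2 - 2 * x)) + (t - (6 * x - 4)) * (4 * x * x - 4 * x)
      = t * (t - (6 * x - 4))"
    if "t\<^sup>2 - (4 * x\<^sup>2 + 2 * x - 4) * t + (6 * x - 4) * (x\<^sup>2 - 2 * x) = 0" for t x :: real
    using that by Groebner_Basis.algebra
  have theta_edge: "2 * x * (- 2 * h) + - (t + 4) * (- 2 * h * x) = t * (- (t + 4) * h)"
    if "t\<^sup>2 + (2 * x + 4) * t + 4 * x = 0" for t x h :: real
    using that by Groebner_Basis.algebra
  from c show ?thesis
  proof (cases rule: weights_cases)
    case anti
    then show ?thesis
      using mn(3) k by (elim disjE) (simp_all add: label_eigenvector_def wave algebra_simps)
  next
    case (const t)
    show ?thesis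
      using mn(3)
    proof (elim disjE)
      assume "u = Edge m n"
      then show ?thesis
        using mu_edge[OF const(4)] by (simp add: label_eigenvector_def const(1-3) wave k algebra_simps)
    qed (simp_all add: label_eigenvector_def const(1-3) wave k algebra_simps power2_eq_square)
  next
    case (left i t)
    show ?thesis
      using mn(3)
    proof (elim disjE)
      assume "u = Edge m n"
      then show ?thesis
        using left(2,3) k theta_edge[OF left(6), of "helmert i m"]
        by (simp add: label_eigenvector_def left(1,4,5) wave algebra_simps)
    qed (use k left(2,3) in \<open>simp_all add: label_eigenvector_def left(1,4,5) wave algebra_simps\<close>)
  next
    case (right j t)
    show ?thesis
      using mn(3)
    proof (elim disjE)
      assume "u = Edge m n"
      then show ?thesis
        using right(2,3) k theta_edge[OF right(6), of "helmert j n"]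
        by (simp add: label_eigenvector_def right(1,4,5) wave algebra_simps)
    qed (use k right(2,3) in \<open>simp_all add: label_eigenvector_def right(1,4,5) wave algebra_simps\<close>)
  next
    case (both i j)
    then show ?thesis
      using mn(3) by (elim disjE) (simp_all add: label_eigenvector_def wave)
  qed
qed

lemma eigenvector_orthogonal_same_mode:
  assumes c: "c \<in> labels k" and d: "d \<in> labels k" and "c \<noteq> d" and mode: "mode c = mode d"
  shows "(\<Sum>v\<in>labels k. label_eigenvector k c v * label_eigenvector k d v) = 0"
proof -
  define ip where "ip c d = (\<Sum>v\<in>labels k. label_eigenvector k c v * label_eigenvector k d v)" for c d
  define N where "N i = (\<Sum>m<k. helmert i m * helmert i m)" for i
  have N0: "N 0 = real k"
    by (simp add: N_def)
  have comm: "ip c d = ip d c" for c d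
    by (simp add: ip_def mult.commute)
  have theta: "(root_theta 1 k + 4) * (root_theta (-1) k + 4) = - 4 * real k"
    using root_theta_mult[of "real k"] by simp
  have mu: "(root_mu 1 k - (6 * real k - 4)) * (root_mu (-1) k - (6 * real k - 4))
      = - 2 * real k * (3 * real k - 2) ^ 2"
    using root_mu_mult[of "real k"] by simp
  have mu': "2 * ((3 * x\<^sup>2 - 2 * x) * (3 * x\<^sup>2 - 2 * x) * x) + a * b * (x * x) = 0"
    if "b * a = - 2 * x * (3 * x - 2)\<^sup>2" for a b x :: real
    using that by Groebner_Basis.algebra
  have theta': "2 * x * (2 * x) * h + - a * - b * (h * x) = 0" if "b * a = - 4 * x" for a b x h :: real
    using that by Groebner_Basis.algebra
  have "ip (Lft i) (Edge i 0) = 0" for i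
    using mu'[OF mu] theta'[OF theta, of "N i"]
    by (cases "i = 0") (simp_all add: ip_def label_eigenvector_def weights_def Let_def sum_wave_mult N0 mult_ac flip: N_def)
  moreover have "ip (Rgt i) (Edge 0 i) = 0" for i
    using theta'[OF theta, of "N i"]
    by (cases "i = 0") (simp_all add: ip_def label_eigenvector_def weights_def Let_def sum_wave_mult N0
        algebra_simps power2_eq_square flip: N_def)
  moreover have "ip (Lft 0) (Rgt 0) = 0"
    by (simp add: ip_def label_eigenvector_def weights_def Let_def sum_wave_mult algebra_simps)
  ultimately have "ip c d = 0"
    using assms by (cases c; cases d) (auto simp: comm)
  then show ?thesis
    by (simp add: ip_def)
qed

text \<open>Left vertices see only the first index of a mode, so \<open>(i, j)\<close> and
  \<open>(i, j')\<close> look alike there. A vanishing left weight whenever the second index is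
  nonzero removes this interference, and symmetrically on the right.\<close>

lemma weights_support:
  assumes "weights k c = (p, q, r)" "mode c = (i, j)"
  shows "j = 0 \<or> p = 0" "i = 0 \<or> q = 0"
  using assms by (auto simp: weights_def Let_def split: if_splits)

lemma eigenvector_orthogonal:
  assumes "c \<in> labels k" "d \<in> labels k" "c \<noteq> d"
  shows "(\<Sum>v\<in>labels k. label_eigenvector k c v * label_eigenvector k d v) = 0"
proof (cases "mode c = mode d")
  case False
  obtain i j p q r where c: "mode c = (i, j)" "weights k c = (p, q, r)"
    by (metis prod_cases3 surj_pair)
  obtain i' j' p' q' r' where d: "mode d = (i', j')" "weights k d = (p', q', r')"
    by (metis prod_cases3 surj_pair)
  have bound: "i < k" "j < k"
    using assms(1) c by (cases c; simp)+
  have bound': "i' < k" "j' < k"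
    using assms(2) d by (cases d; simp)+
  have "i \<noteq> i' \<or> j \<noteq> j'"
    using False c d by simp
  moreover define H where "H i j = (\<Sum>m<k. helmert i m * helmert j m)" for i j
  ultimately have "p * p' * H i i' + q * q' * H j j' + r * r' * (H i i' * H j j') = 0"
    using bound bound' weights_support[OF c(2,1)] weights_support[OF d(2,1)]
      helmert_orthogonal[of i k i'] helmert_orthogonal[of j k j']
    by (cases "i = i'"; cases "j = j'"; auto)
  then show ?thesis
    by (simp add: label_eigenvector_def c d sum_wave_mult H_def)
qed (use assms eigenvector_orthogonal_same_mode in blast)

lemma eigenvector_norm_nonzero:
  assumes "c \<in> labels k"
  shows "(\<Sum>v\<in>labels k. label_eigenvector k c v * label_eigenvector k c v) \<noteq> 0"
proof -
  have k: "0 < k"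
    using assms by (cases c) auto
  define N where "N i = (\<Sum>m<k. helmert i m * helmert i m)" for i
  have N: "N i > 0" if "i < k" for i
    unfolding N_def by (rule helmert_norm_pos[OF that])
  obtain i j p q r where c: "mode c = (i, j)" "weights k c = (p, q, r)"
    by (metis prod_cases3 surj_pair)
  have ij: "i < k" "j < k"
    using assms c by (cases c; simp)+
  have "3 * real k ^ 2 - 2 * real k = real k * (3 * real k - 2)"
    by (simp add: power2_eq_square algebra_simps)
  \<comment> \<open>The only positive zero is \<open>2/3\<close>, which is not an integer.\<close>
  also have "\<dots> \<noteq> 0"
    using k by simp
  finally have nz: "p \<noteq> 0 \<or> q \<noteq> 0 \<or> r \<noteq> 0"
    using c(2) k by (auto simp: weights_def Let_def split: if_splits)
  have "(\<Sum>v\<in>labels k. label_eigenvector k c v * label_eigenvector k c v) =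
      p\<^sup>2 * N i + q\<^sup>2 * N j + r\<^sup>2 * (N i * N j)"
    by (simp add: label_eigenvector_def c sum_wave_mult N_def power2_eq_square)
  also have "\<dots> \<noteq> 0"
    using nz N[OF ij(1)] N[OF ij(2)] by (simp add: add_nonneg_eq_0_iff)
  finally show ?thesis .
qed

section \<open>Multiplicities of the eigenvalues\<close>

lemma image_eigenvalue_labels:
  assumes "k > 0"
  shows "image_mset (label_eigenvalue k) (mset_set (labels k)) =
    {# root_mu 1 k, root_mu (-1) k, 2 * real k - 4 #} + replicate_mset ((k - 1)\<^sup>2) 0
    + replicate_mset (2 * k - 2) (root_theta 1 k) + replicate_mset (2 * k - 2) (root_theta (-1) k)"
proof -
  obtain l where l: "k = Suc l"
    using assms by (cases k) auto
  have split: "mset_set {..<k} = {#0#} + mset_set {1..<k}"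
    by (simp add: l lessThan_atLeast0 atLeast0_lessThan_Suc_eq_insert_0 image_Suc_lessThan)
  have const: "image_mset f (mset_set S) = replicate_mset (card S) a" if "\<And>x. x \<in> S \<Longrightarrow> f x = a"
    for f :: "'c \<Rightarrow> real" and S a
  proof (cases "finite S")
    case True
    then have "image_mset f (mset_set S) = image_mset (\<lambda>_. a) (mset_set S)"
      using that by (intro image_mset_cong) auto
    then show ?thesis by (simp add: image_mset_const_eq)
  qed simp
  \<comment> \<open>Corner, two axes and interior of the edge grid carry \<open>root_mu 1 k\<close>,
    \<open>root_theta 1 k\<close> and 0 respectively.\<close>
  have grid: "mset_set ({..<k} \<times> {..<k}) = {#(0, 0)#} + mset_set ((\<lambda>i. (i, 0)) ` {1..<k})
      + mset_set ((\<lambda>j. (0, j)) ` {1..<k}) + mset_set ({1..<k} \<times> {1..<k})"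
  proof -
    have "{..<k} \<times> {..<k} = {(0, 0)} \<union> (\<lambda>i. (i, 0)) ` {1..<k} \<union> (\<lambda>j. (0, j)) ` {1..<k} \<union> {1..<k} \<times> {1..<k}"
      using assms by (auto simp: image_iff Suc_le_eq)
    then show ?thesis
      by (simp only:) (subst mset_set_Union | force)+
  qed
  have "image_mset (label_eigenvalue k \<circ> Lft) (mset_set {..<k}) =
      {# root_mu (-1) k #} + replicate_mset (k - 1) (root_theta (-1) k)"
    unfolding split by (subst image_mset_union, subst const[of "{1..<k}" _ "root_theta (-1) k"]) auto
  moreover have "image_mset (label_eigenvalue k \<circ> Rgt) (mset_set {..<k}) =
      {# 2 * real k - 4 #} + replicate_mset (k - 1) (root_theta (-1) k)"
    unfolding split by (subst image_mset_union, subst const[of "{1..<k}" _ "root_theta (-1) k"]) auto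
  moreover have "image_mset (label_eigenvalue k \<circ> case_prod Edge) (mset_set ({..<k} \<times> {..<k})) =
      {# root_mu 1 k #} + replicate_mset (k - 1) (root_theta 1 k) + replicate_mset (k - 1) (root_theta 1 k)
      + replicate_mset ((k - 1)\<^sup>2) 0"
    unfolding grid image_mset_union
    by (subst const[of "(\<lambda>i. (i, 0)) ` {1..<k}" _ "root_theta 1 k"], force,
        subst const[of "(\<lambda>j. (0, j)) ` {1..<k}" _ "root_theta 1 k"], force,
        subst const[of "{1..<k} \<times> {1..<k}" _ 0], force)
      (simp add: card_image inj_on_def power2_eq_square)
  moreover have "replicate_mset (2 * k - 2) a = replicate_mset (k - 1) a + replicate_mset (k - 1) a" for a :: real
    by (rule multiset_eqI) (simp add: l)
  ultimately show ?thesis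
    by (simp add: mset_set_labels image_mset.compositionality)
qed

section \<open>The subdivision graph of a complete bipartite graph\<close>

fun adjacent :: "label \<Rightarrow> label \<Rightarrow> bool" where
  "adjacent (Lft i) (Edge m n) \<longleftrightarrow> i = m"
| "adjacent (Rgt j) (Edge m n) \<longleftrightarrow> j = n"
| "adjacent (Edge m n) (Lft i) \<longleftrightarrow> m = i"
| "adjacent (Edge m n) (Rgt j) \<longleftrightarrow> n = j"
| "adjacent _ _ \<longleftrightarrow> False"

lemma label_dist_refl: "label_dist x x = 0"
  by (cases x) auto

lemma label_dist_step: "adjacent y z \<Longrightarrow> label_dist x z \<le> label_dist x y + 1"
  by (cases x; cases y; cases z) auto

text \<open>Each witness is the last vertex but one on a shortest path from \<open>x\<close> to
  \<open>z\<close>. Where any edge at \<open>z\<close> would do, index 0 is chosen.\<close>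

lemma label_dist_pred:
  assumes "x \<in> labels k" "z \<in> labels k" "z \<noteq> x"
  shows "\<exists>y\<in>labels k. adjacent y z \<and> label_dist x z = label_dist x y + 1"
proof (cases x)
  case x: (Lft i)
  show ?thesis
  proof (cases z)
    case (Lft j)
    then show ?thesis using assms x by (intro bexI[of _ "Edge j 0"]) auto
  next
    case (Rgt j)
    then show ?thesis using assms x by (intro bexI[of _ "Edge i j"]) auto
  next
    case (Edge m n)
    then show ?thesis
      using assms x by (intro bexI[of _ "if i = m then Lft i else Rgt n"]) auto
  qed
next
  case x: (Rgt i)
  show ?thesis
  proof (cases z)
    case (Lft j)
    then show ?thesis using assms x by (intro bexI[of _ "Edge j i"]) auto
  next
    case (Rgt j)
    then show ?thesis using assms x by (intro bexI[of _ "Edge 0 j"]) auto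
  next
    case (Edge m n)
    then show ?thesis
      using assms x by (intro bexI[of _ "if i = n then Rgt i else Lft m"]) auto
  qed
next
  case x: (Edge p q)
  show ?thesis
  proof (cases z)
    case (Lft j)
    then show ?thesis
      using assms x by (intro bexI[of _ "Edge j q"]) auto
  next
    case (Rgt j)
    then show ?thesis
      using assms x by (intro bexI[of _ "Edge p j"]) auto
  next
    case (Edge m n)
    then show ?thesis
      using assms x by (intro bexI[of _ "if n = q then Rgt n else Lft m"]) auto
  qed
qed

fun vertex :: "(nat \<Rightarrow> 'a) \<Rightarrow> (nat \<Rightarrow> 'a) \<Rightarrow> label \<Rightarrow> 'a + 'a set" where
  "vertex \<alpha> \<beta> (Lft i) = Inl (\<alpha> i)"
| "vertex \<alpha> \<beta> (Rgt j) = Inl (\<beta> j)"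
| "vertex \<alpha> \<beta> (Edge i j) = Inr {\<alpha> i, \<beta> j}"

lemma subdivision_complete_bipartite:
  fixes G :: "('a, 'b) pre_digraph"
  assumes \<alpha>: "bij_betw \<alpha> {..<k} A" and \<beta>: "bij_betw \<beta> {..<k} B" and AB: "A \<inter> B = {}"
    and V: "verts G = A \<union> B" and E: "arcs_ends G = A \<times> B \<union> B \<times> A"
  shows "bij_betw (vertex \<alpha> \<beta>) (labels k) (pverts (subdivision_graph G))"
    and "parcs (subdivision_graph G) =
      {(vertex \<alpha> \<beta> x, vertex \<alpha> \<beta> y) | x y. x \<in> labels k \<and> y \<in> labels k \<and> adjacent x y}"
proof -
  have img: "A = \<alpha> ` {..<k}" "B = \<beta> ` {..<k}"
    using \<alpha> \<beta> by (auto simp: bij_betw_def)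
  have \<alpha>_eq: "\<alpha> i = \<alpha> j \<longleftrightarrow> i = j" if "i < k" "j < k" for i j
    using \<alpha> that by (auto simp: bij_betw_def inj_on_def)
  have \<beta>_eq: "\<beta> i = \<beta> j \<longleftrightarrow> i = j" if "i < k" "j < k" for i j
    using \<beta> that by (auto simp: bij_betw_def inj_on_def)
  have \<alpha>\<beta>: "\<alpha> i \<noteq> \<beta> j" if "i < k" "j < k" for i j
    using AB that by (auto simp: img)
  have "inj_on (vertex \<alpha> \<beta>) (labels k)"
  proof (rule inj_onI)
    fix x y assume "x \<in> labels k" "y \<in> labels k" "vertex \<alpha> \<beta> x = vertex \<alpha> \<beta> y"
    then show "x = y"
      by (cases x; cases y) (auto simp: \<alpha>_eq \<beta>_eq \<alpha>\<beta> \<alpha>\<beta>[symmetric] doubleton_eq_iff)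
  qed
  \<comment> \<open>Both orientations of an edge name the same doubleton, so listing the left end
    first reaches every new vertex.\<close>
  have edge_vertices: "{Inr {u, v} | u v. (u, v) \<in> arcs_ends G} = (\<lambda>(i, j). Inr {\<alpha> i, \<beta> j}) ` ({..<k} \<times> {..<k})"
    unfolding E img by (auto simp: insert_commute)
  have "vertex \<alpha> \<beta> ` labels k = pverts (subdivision_graph G)"
    by (simp add: subdivision_graph_def edge_vertices V img labels_def image_Un image_image case_prod_unfold)
  then show "bij_betw (vertex \<alpha> \<beta>) (labels k) (pverts (subdivision_graph G))"
    using \<open>inj_on _ _\<close> by (simp add: bij_betw_def)
  define S where "S = {(vertex \<alpha> \<beta> x, vertex \<alpha> \<beta> y) | x y. x \<in> labels k \<and> y \<in> labels k \<and> adjacent x y}"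
  have S: "(vertex \<alpha> \<beta> x, vertex \<alpha> \<beta> y) \<in> S" if "x \<in> labels k" "y \<in> labels k" "adjacent x y" for x y
    using that unfolding S_def by blast
  have "p \<in> parcs (subdivision_graph G) \<longleftrightarrow> p \<in> S" for p
  proof -
    define P where "P u v \<longleftrightarrow> p = (Inl u, Inr {u, v}) \<or> p = (Inr {u, v}, Inl u)" for u v
    have "p \<in> parcs (subdivision_graph G) \<longleftrightarrow> (\<exists>u v. (u, v) \<in> arcs_ends G \<and> P u v)"
      unfolding subdivision_graph_def P_def by auto
    also have "\<dots> \<longleftrightarrow> (\<exists>a\<in>A. \<exists>b\<in>B. P a b \<or> P b a)"
      unfolding E by blast
    also have "\<dots> \<longleftrightarrow> (\<exists>i<k. \<exists>j<k. P (\<alpha> i) (\<beta> j) \<or> P (\<beta> j) (\<alpha> i))"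
      by (auto simp: img)
    also have "\<dots> \<longleftrightarrow> p \<in> S"
    proof
      assume "\<exists>i<k. \<exists>j<k. P (\<alpha> i) (\<beta> j) \<or> P (\<beta> j) (\<alpha> i)"
      then obtain i j where "i < k" "j < k" "P (\<alpha> i) (\<beta> j) \<or> P (\<beta> j) (\<alpha> i)"
        by blast
      then show "p \<in> S"
        using S[of "Lft i" "Edge i j"] S[of "Edge i j" "Lft i"] S[of "Rgt j" "Edge i j"] S[of "Edge i j" "Rgt j"]
        unfolding P_def insert_commute[of "\<beta> _" "\<alpha> _"] by (elim disjE) simp_all
    next
      assume "p \<in> S"
      then obtain x y where "p = (vertex \<alpha> \<beta> x, vertex \<alpha> \<beta> y)" "x \<in> labels k" "y \<in> labels k" "adjacent x y"
        unfolding S_def by blast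
      then show "\<exists>i<k. \<exists>j<k. P (\<alpha> i) (\<beta> j) \<or> P (\<beta> j) (\<alpha> i)"
        unfolding P_def insert_commute[of "\<beta> _" "\<alpha> _"] by (cases x; cases y) auto
    qed
    finally show ?thesis .
  qed
  then show "parcs (subdivision_graph G) =
      {(vertex \<alpha> \<beta> x, vertex \<alpha> \<beta> y) | x y. x \<in> labels k \<and> y \<in> labels k \<and> adjacent x y}"
    unfolding S_def[symmetric] by blast
qed

lemma graph_dist_subdivision_complete_bipartite:
  fixes G :: "('a, 'b) pre_digraph"
  assumes "bij_betw \<alpha> {..<k} A" "bij_betw \<beta> {..<k} B" "A \<inter> B = {}"
    and "verts G = A \<union> B" "arcs_ends G = A \<times> B \<union> B \<times> A"
    and x: "x \<in> labels k" and y: "y \<in> labels k"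
  shows "graph_dist (with_proj (subdivision_graph G)) (vertex \<alpha> \<beta> x) (vertex \<alpha> \<beta> y) = label_dist x y"
proof -
  let ?S = "with_proj (subdivision_graph G)" and ?\<iota> = "vertex \<alpha> \<beta>"
  note bij = subdivision_complete_bipartite(1)[OF assms(1-5)]
    and arcs = subdivision_complete_bipartite(2)[OF assms(1-5)]
  \<comment> \<open>The certificate for distances is \<open>label_dist x\<close>, transported to the
    vertices.\<close>
  define f where "f v = label_dist x (inv_into (labels k) ?\<iota> v)" for v
  have f: "f (?\<iota> z) = label_dist x z" if "z \<in> labels k" for z
    using bij that by (simp add: f_def bij_betw_def)
  have verts: "verts ?S = ?\<iota> ` labels k"
    using bij by (simp add: bij_betw_def)
  have ends: "arcs_ends ?S = {(?\<iota> x, ?\<iota> y) | x y. x \<in> labels k \<and> y \<in> labels k \<and> adjacent x y}"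
    by (simp add: arcs_ends_conv arcs)
  have wf: "wf_digraph ?S"
    using verts by unfold_locales (auto simp: arcs)
  have "graph_dist ?S (?\<iota> x) (?\<iota> y) = f (?\<iota> y)"
  proof (rule wf_digraph_graph_dist_eqI[OF wf])
    show "f v \<le> f u + 1" if "(u, v) \<in> arcs_ends ?S" for u v
      using that unfolding ends by (auto simp: f dest: label_dist_step[of _ _ x])
    show "\<exists>u. (u, v) \<in> arcs_ends ?S \<and> f v = f u + 1" if v: "v \<in> verts ?S" "v \<noteq> ?\<iota> x" for v
    proof -
      obtain z where z: "z \<in> labels k" "v = ?\<iota> z" "z \<noteq> x"
        using v verts by auto
      from label_dist_pred[OF x z(1,3)] obtain w
        where "w \<in> labels k" "adjacent w z" "label_dist x z = label_dist x w + 1" by blast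
      with z show ?thesis
        unfolding ends by (intro exI[of _ "?\<iota> w"]) (auto simp: f)
    qed
  qed (use x y f label_dist_refl in \<open>auto simp: verts simp del: with_proj_simps\<close>)
  then show ?thesis
    using f y by simp
qed

theorem theorem3p5:
  fixes G :: "('a, 'b) pre_digraph" and k :: nat and vs :: "('a + 'a set) list"
  assumes "minimal_cage k 4 G"
    and "distinct vs" and "set vs = pverts (subdivision_graph G)"
  shows "distance_spectrum (with_proj (subdivision_graph G)) vs =
    {# 2 * real k ^ 2 + real k - 2
         + sqrt (4 * real k ^ 4 - 2 * real k ^ 3 + 9 * real k ^ 2 - 12 * real k + 4),
       2 * real k ^ 2 + real k - 2
         - sqrt (4 * real k ^ 4 - 2 * real k ^ 3 + 9 * real k ^ 2 - 12 * real k + 4),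
       2 * real k - 4 #}
    + replicate_mset ((k - 1) ^ 2) 0
    + replicate_mset (2 * k - 2) (- (real k + 2) + sqrt (real k ^ 2 + 4))
    + replicate_mset (2 * k - 2) (- (real k + 2) - sqrt (real k ^ 2 + 4))"
proof -
  from assms(1) obtain A B where AB: "finite A" "finite B" "card A = k" "card B = k" "A \<inter> B = {}"
    "verts G = A \<union> B" "arcs_ends G = A \<times> B \<union> B \<times> A" and k: "k > 0"
    by (rule minimal_cage_4_complete_bipartite)
  obtain \<alpha> \<beta> where ab: "bij_betw \<alpha> {..<k} A" "bij_betw \<beta> {..<k} B"
    using AB(1-4) ex_bij_betw_nat_finite[of A] ex_bij_betw_nat_finite[of B] lessThan_atLeast0 by metis
  let ?\<iota> = "vertex \<alpha> \<beta>"
  note bij = subdivision_complete_bipartite(1)[OF ab AB(5-7)]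
  \<comment> \<open>Labels are listed in the order of \<open>vs\<close>, so the two matrices agree
    entry by entry and no permutation intervenes.\<close>
  define xs where "xs = map (inv_into (labels k) ?\<iota>) vs"
  have bij': "bij_betw (inv_into (labels k) ?\<iota>) (set vs) (labels k)"
    using bij_betw_inv_into[OF bij] assms(3) by simp
  then have xs: "distinct xs" "set xs = labels k" "length xs = length vs"
    using assms(2) by (auto simp: xs_def distinct_map bij_betw_def)
  have vs_nth: "vs ! i = ?\<iota> (xs ! i)" and xs_nth: "xs ! i \<in> labels k" if "i < length vs" for i
    using that bij assms(3) nth_mem[of i vs] nth_mem[of i xs] xs
    by (auto simp: xs_def bij_betw_def intro: f_inv_into_f[symmetric])
  have "distance_matrix (with_proj (subdivision_graph G)) vs =
      mat (length xs) (length xs) (\<lambda>(i, j). real (label_dist (xs ! i) (xs ! j)))"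
    unfolding distance_matrix_def
    by (rule eq_matI) (auto simp: xs(3) vs_nth xs_nth graph_dist_subdivision_complete_bipartite[OF ab AB(5-7)])
  then have "distance_spectrum (with_proj (subdivision_graph G)) vs = image_mset (label_eigenvalue k) (mset xs)"
    unfolding distance_spectrum_def
    using proots_char_poly_orthogonal_eigenvectors[OF xs(1), of "\<lambda>x y. real (label_dist x y)" "label_eigenvector k" "label_eigenvalue k"]
      eigenvector_eigenvalue eigenvector_orthogonal eigenvector_norm_nonzero
    by (simp add: xs(2))
  also have "mset xs = mset_set (labels k)"
    using xs mset_set_set by metis
  finally show ?thesis
    unfolding image_eigenvalue_labels[OF k] by (simp add: root_mu_def root_theta_def)
qed

end
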